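(* Let $N\ge1$ be an integer, $k=(k_1,\dots,k_N)\in\mathbb R_{>0}^N$ and $0<c<1$. The operator $L^{\mathrm{SIP}}$ is self-dual, with duality function $$D(n,x)=\prod_{j=1}^N M(n_j,x_j;k_j,c),\qquad n,x\in\mathbb N^N,$$ i.e. $[L^{\mathrm{SIP}}D(\cdot,x)](n)=[L^{\mathrm{SIP}}D(n,\cdot)](x)$ for all $n,x\in\mathbb N^N$.
   Context: $\mathbb N$ is the set of nonnegative integers. $L^{\mathrm{SIP}}$ is the generator of the symmetric inclusion process SIP($k$): for $f:\mathbb N^N\to\mathbb C$, $$L^{\mathrm{SIP}}f(n)=\sum_{1\le i<j\le N}\Big[n_i(2k_j+n_j)\big(f(n^{i,j})-f(n)\big)+n_j(2k_i+n_i)\big(f(n^{j,i})-f(n)\big)\Big],$$ where $n^{i,j}=n-e_i+e_j$ with $e_i$ the $i$-th standard basis vector (a term with prefactor $n_i=0$ is zero). The Meixner polynomials are $M_n(x;\beta,c)=\sum_{m=0}^{n}\frac{(-n)_m(-x)_m}{(\beta)_m\,m!}\left(1-\frac1c\right)^m$, where $(a)_m=a(a+1)\cdots(a+m-1)$, $(a)_0=1$, and $M(n,x;k,c)=M_n(x;2k,c)$. *)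

theory Defs
  imports "HOL-Analysis.Analysis"
begin

text \<open>
  Configurations in \<open>\<nat>\<^sup>N\<close> are vectors of type \<open>nat ^ 'n\<close> with \<open>N = CARD('n) \<ge> 1\<close>. The index type
  carries a linear order, so that the sum over \<open>1 \<le> i < j \<le> N\<close> is a sum over pairs \<open>i < j\<close>.
\<close>

text \<open>
  The subtraction is the truncated one of \<open>nat\<close>; it is only relevant where \<open>n $ i \<ge> 1\<close>, since
  in the generator the term is multiplied by \<open>n $ i\<close>.
\<close>

definition move :: "nat ^ 'n \<Rightarrow> 'n \<Rightarrow> 'n \<Rightarrow> nat ^ 'n" where
  "move n i j = n - axis i 1 + axis j 1"

definition L_SIP ::
  "real ^ ('n :: {finite, linorder}) \<Rightarrow> (nat ^ ('n :: {finite, linorder}) \<Rightarrow> complex)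
     \<Rightarrow> nat ^ ('n :: {finite, linorder}) \<Rightarrow> complex" where
  "L_SIP k f n =
     (\<Sum>(i, j) \<in> {(i, j). i < j}.
        of_real (real (n $ i) * (2 * k $ j + real (n $ j))) * (f (move n i j) - f n) +
        of_real (real (n $ j) * (2 * k $ i + real (n $ i))) * (f (move n j i) - f n))"

definition Meixner :: "nat \<Rightarrow> real \<Rightarrow> real \<Rightarrow> real \<Rightarrow> real" where
  "Meixner n x \<beta> c =
     (\<Sum>m = 0..n. pochhammer (- real n) m * pochhammer (- x) m / (pochhammer \<beta> m * fact m)
                 * (1 - 1 / c) ^ m)"

definition M_SIP :: "nat \<Rightarrow> nat \<Rightarrow> real \<Rightarrow> real \<Rightarrow> real" where
  "M_SIP n x k c = Meixner n (real x) (2 * k) c"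

definition D_SIP :: "real ^ 'n \<Rightarrow> real \<Rightarrow> nat ^ 'n \<Rightarrow> nat ^ 'n \<Rightarrow> complex" where
  "D_SIP k c n x = of_real (\<Prod>j\<in>UNIV. M_SIP (n $ j) (x $ j) (k $ j) c)"

end

theory Submission
  imports Defs
begin

text \<open>
  Write \<open>M n x = (\<Sum>m. (n choose m) (x choose m) w m)\<close> with \<open>w m = m! (1 - 1/c)\<^sup>m / (\<beta>)\<^sub>m\<close>, which is
  symmetric in \<open>n\<close> and \<open>x\<close>. Then \<open>n (M n x - M (n-1) x) = x (M n x - M n (x-1))\<close> and
  \<open>c (\<beta>+n) M (n+1) x = c (n+x+\<beta>) M n x - x M n (x-1)\<close>, the first termwise, the second by
  telescoping. Together with the mirror image of the second under symmetry, these relations turn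
  the two-site duality into a polynomial identity; the factors of \<open>D\<close> at the other sites are
  spectators.
\<close>

definition weight :: "real \<Rightarrow> real \<Rightarrow> nat \<Rightarrow> real" where
  "weight \<beta> c m = fact m * (1 - 1 / c) ^ m / pochhammer \<beta> m"

lemma pochhammer_minus_of_nat:
  "pochhammer (- real n) m = (-1) ^ m * fact m * real (n choose m)"
  by (simp add: binomial_gbinomial gbinomial_pochhammer)

text \<open>The signs of the two Pochhammer symbols cancel, and terms with \<open>m > n\<close>
  vanish with \<open>n choose m\<close>. The free bound \<open>B\<close> lets polynomials of
  different degrees be summed over one common range.\<close>

lemma Meixner_eq_sum_binomial:
  assumes "\<beta> > 0" "n < B"
  shows "Meixner n (real x) \<beta> c =
    (\<Sum>m<B. real (n choose m) * real (x choose m) * weight \<beta> c m)"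
proof -
  have "Meixner n (real x) \<beta> c = (\<Sum>m=0..n. real (n choose m) * real (x choose m) * weight \<beta> c m)"
    unfolding Meixner_def
  proof (rule sum.cong [OF refl])
    fix m
    have "(-1::real) ^ m * (-1) ^ m = 1"
      by (simp flip: power_mult_distrib)
    moreover have "pochhammer (- real n) m * pochhammer (- real x) m =
      ((-1) ^ m * (-1) ^ m) * (fact m * fact m * (real (n choose m) * real (x choose m)))"
      unfolding pochhammer_minus_of_nat by (simp only: ac_simps)
    ultimately have "pochhammer (- real n) m * pochhammer (- real x) m =
      fact m * fact m * (real (n choose m) * real (x choose m))"
      by simp
    then show "pochhammer (- real n) m * pochhammer (- real x) m / (pochhammer \<beta> m * fact m)
        * (1 - 1 / c) ^ m = real (n choose m) * real (x choose m) * weight \<beta> c m"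
      by (simp add: weight_def)
  qed
  also have "\<dots> = (\<Sum>m<B. real (n choose m) * real (x choose m) * weight \<beta> c m)"
    using assms(2) by (intro sum.mono_neutral_left) auto
  finally show ?thesis .
qed

lemma Meixner_commute:
  assumes "\<beta> > 0"
  shows "Meixner n (real x) \<beta> c = Meixner x (real n) \<beta> c"
  using assms
  by (simp add: Meixner_eq_sum_binomial [where B = "Suc (n + x)"] mult.commute)

text \<open>Pascal's rule followed by absorption. At \<open>n = 0\<close> the truncated
  \<open>n - 1\<close> is harmless because of the factor \<open>n\<close>.\<close>

lemma binomial_backward_difference:
  "real n * (real (n choose m) - real ((n - 1) choose m)) = real m * real (n choose m)"
proof (cases n)
  case (Suc n')
  show ?thesis
  proof (cases m)
    case (Suc m')
    have "real (Suc n') * real (n' choose m') = real (Suc m') * real (Suc n' choose Suc m')"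
      using Suc_times_binomial_eq [of n' m'] by (metis of_nat_mult mult.commute)
    then show ?thesis
      using \<open>n = Suc n'\<close> Suc by simp
  qed simp
qed (cases m; simp)

text \<open>The difference \<open>real n - real m\<close> is signed; for \<open>m > n\<close> both
  sides vanish through the binomials.\<close>

lemma binomial_absorb_upper:
  "real (Suc m) * real (n choose Suc m) = (real n - real m) * real (n choose m)"
proof (cases "m \<le> n")
  case True
  have "(n choose Suc m) * Suc m = (n choose m) * (n - m)"
    using binomial_absorption [of m n] binomial_absorb_comp [of n m] by (cases n) (auto simp: mult.commute)
  then have "real (n choose Suc m) * real (Suc m) = real (n choose m) * real (n - m)"
    by (metis of_nat_mult)
  with True show ?thesis
    by (simp add: of_nat_diff mult.commute)
qed (simp add: binomial_eq_0)

text \<open>The point is the shape of the right-hand side: it is symmetric in \<open>n\<close> and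
  \<open>x\<close>, so that the backward difference in \<open>x\<close> must give the same
  sum.\<close>

lemma Meixner_backward_difference:
  assumes "\<beta> > 0"
  shows "real n * (Meixner n (real x) \<beta> c - Meixner (n - 1) (real x) \<beta> c) =
    (\<Sum>m<Suc (n + x). real m * real (n choose m) * real (x choose m) * weight \<beta> c m)"
proof -
  have "real n * (real (n choose m) * real (x choose m) * weight \<beta> c m
      - real ((n - 1) choose m) * real (x choose m) * weight \<beta> c m) =
    real m * real (n choose m) * real (x choose m) * weight \<beta> c m" for m
    using binomial_backward_difference [of n m] by algebra
  then show ?thesis
    using assms
    by (simp add: Meixner_eq_sum_binomial [where B = "Suc (n + x)"] sum_distrib_left
        flip: sum_subtractf del: sum.lessThan_Suc)
qed

lemma Meixner_backward_difference_commute: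
  assumes "\<beta> > 0"
  shows "real n * (Meixner n (real x) \<beta> c - Meixner (n - 1) (real x) \<beta> c) =
    real x * (Meixner n (real x) \<beta> c - Meixner n (real (x - 1)) \<beta> c)"
  using Meixner_backward_difference [OF assms, of n x c]
    Meixner_backward_difference [OF assms, of x n c]
    Meixner_commute [OF assms, of n x c] Meixner_commute [OF assms, of n "x - 1" c]
  by (simp add: ac_simps del: sum.lessThan_Suc)

text \<open>The ratio of consecutive weights, cleared of denominators by
  \<open>c * (1 - 1 / c) = c - 1\<close>.\<close>

lemma weight_Suc:
  assumes "\<beta> > 0" "c \<noteq> 0"
  shows "c * (\<beta> + real m) * weight \<beta> c (Suc m) = (c - 1) * real (Suc m) * weight \<beta> c m"
proof -
  have "pochhammer \<beta> m > 0" "\<beta> + real m > 0"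
    using assms by (auto intro: pochhammer_pos)
  then have "(\<beta> + real m) * weight \<beta> c (Suc m) = real (Suc m) * (1 - 1 / c) * weight \<beta> c m"
    by (simp add: weight_def pochhammer_Suc)
  moreover have "c * (1 - 1 / c) = c - 1"
    using assms by (simp add: right_diff_distrib)
  ultimately show ?thesis
    by algebra
qed

lemma Meixner_raise:
  assumes "\<beta> > 0" "c \<noteq> 0"
  shows "c * (\<beta> + real n) * Meixner (Suc n) (real x) \<beta> c =
    c * (real n + real x + \<beta>) * Meixner n (real x) \<beta> c - real x * Meixner n (real (x - 1)) \<beta> c"
proof -
  \<comment> \<open>This is the range of \<open>Meixner_backward_difference\<close>; it exceeds
    \<open>n\<close>, so \<open>t B = 0\<close>.\<close>
  define B where "B = n + x + 1"
  define t where "t m = real (n choose m) * real (x choose m) * weight \<beta> c m" for m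
  define b where "b m = real (n choose m) * real (x choose Suc m) * weight \<beta> c (Suc m)" for m
  have M: "Meixner n (real x) \<beta> c = (\<Sum>m<B. t m)"
    using assms by (simp add: Meixner_eq_sum_binomial [where B = B] B_def t_def del: sum.lessThan_Suc)
  have "Meixner (Suc n) (real x) \<beta> c - Meixner n (real x) \<beta> c =
      (\<Sum>m<Suc B. (real (Suc n choose m) - real (n choose m)) * real (x choose m) * weight \<beta> c m)"
    using assms by (simp add: Meixner_eq_sum_binomial [where B = "Suc B"] B_def left_diff_distrib
        sum_subtractf del: sum.lessThan_Suc)
  \<comment> \<open>The term at index 0 vanishes, and after the shift Pascal's rule leaves
    \<open>n choose m\<close>.\<close>
  also have "\<dots> = (\<Sum>m<B. b m)"
    unfolding sum.lessThan_Suc_shift by (simp add: b_def)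
  finally have S: "Meixner (Suc n) (real x) \<beta> c = (\<Sum>m<B. t m) + (\<Sum>m<B. b m)"
    using M by simp
  have X: "real x * (Meixner n (real x) \<beta> c - Meixner n (real (x - 1)) \<beta> c) = (\<Sum>m<B. real m * t m)"
    using Meixner_backward_difference_commute [OF assms(1), of n x c]
      Meixner_backward_difference [OF assms(1), of n x c]
    by (simp add: B_def t_def mult.assoc del: sum.lessThan_Suc)
  \<comment> \<open>Absorption in \<open>n\<close> turns \<open>real (Suc m) * t (Suc m)\<close>
    into \<open>(n - m) * b m\<close>. Since
    \<open>c * (\<beta> + n) - c * (n - m) = c * (\<beta> + m)\<close>, exactly the factor required
    by \<open>weight_Suc\<close> remains on \<open>b m\<close>; absorption in \<open>x\<close> then
    finishes.\<close>
  have "c * (\<beta> + real n) * b m - real m * t m - (c - 1) * real x * t m =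
      c * (real (Suc m) * t (Suc m) - real m * t m)" for m
  proof -
    have "\<beta> + real m \<noteq> 0"
      using assms(1) by simp
    moreover have "(\<beta> + real m) * (c * (\<beta> + real n) * b m - real m * t m - (c - 1) * real x * t m) =
      (\<beta> + real m) * (c * (real (Suc m) * t (Suc m) - real m * t m))"
      using weight_Suc [OF assms, of m] binomial_absorb_upper [of m n]
        binomial_absorb_upper [of m x]
      unfolding b_def t_def by algebra
    ultimately show ?thesis
      by simp
  qed
  then have "(\<Sum>m<B. c * (\<beta> + real n) * b m - real m * t m - (c - 1) * real x * t m) =
      c * (\<Sum>m<B. real (Suc m) * t (Suc m) - real m * t m)"
    by (simp add: sum_distrib_left)
  \<comment> \<open>Both boundary terms vanish: the lower one by the factor \<open>m = 0\<close>,
    the upper one by \<open>n choose B = 0\<close>.\<close>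
  also have "\<dots> = 0"
    unfolding sum_lessThan_telescope [of "\<lambda>m. real m * t m" B] by (simp add: t_def B_def)
  finally have Z: "c * (\<beta> + real n) * (\<Sum>m<B. b m) - (\<Sum>m<B. real m * t m)
      - (c - 1) * real x * (\<Sum>m<B. t m) = 0"
    by (simp add: sum_subtractf sum_distrib_left)
  \<comment> \<open>The final elimination is done over arbitrary reals, so that simplification
    cannot disturb the sums.\<close>
  have "c * (\<beta> + p) * (T + U) = c * (p + r + \<beta>) * T - r * q"
    if "r * (T - q) = V" "c * (\<beta> + p) * U - V - (c - 1) * r * T = 0" for p q r T U V :: real
  proof -
    have "c * (\<beta> + p) * U = c * r * T - r * q"
      using that by (simp add: algebra_simps)
    then show ?thesis
      by (simp add: algebra_simps)
  qed
  from this [OF X [unfolded M] Z] show ?thesis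
    by (simp only: M S)
qed

lemma Meixner_two_site_duality:
  fixes n1 n2 x1 x2 :: nat
  assumes "\<beta>1 > 0" "\<beta>2 > 0" "c \<noteq> 0"
  defines "M1 \<equiv> \<lambda>n x. Meixner n (real x) \<beta>1 c" and "M2 \<equiv> \<lambda>n x. Meixner n (real x) \<beta>2 c"
  shows
    "real n1 * (\<beta>2 + real n2) * (M1 (n1 - 1) x1 * M2 (Suc n2) x2 - M1 n1 x1 * M2 n2 x2) +
     real n2 * (\<beta>1 + real n1) * (M1 (Suc n1) x1 * M2 (n2 - 1) x2 - M1 n1 x1 * M2 n2 x2) =
     real x1 * (\<beta>2 + real x2) * (M1 n1 (x1 - 1) * M2 n2 (Suc x2) - M1 n1 x1 * M2 n2 x2) +
     real x2 * (\<beta>1 + real x1) * (M1 n1 (Suc x1) * M2 n2 (x2 - 1) - M1 n1 x1 * M2 n2 x2)"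
    (is "?L = ?R")
proof -
  have comm: "M1 n x = M1 x n" "M2 n x = M2 x n" for n x
    unfolding M1_def M2_def using assms by (simp_all add: Meixner_commute)
  have raise_n:
    "c * (\<beta>1 + real n1) * M1 (Suc n1) x1 =
      c * (real n1 + real x1 + \<beta>1) * M1 n1 x1 - real x1 * M1 n1 (x1 - 1)"
    "c * (\<beta>2 + real n2) * M2 (Suc n2) x2 =
      c * (real n2 + real x2 + \<beta>2) * M2 n2 x2 - real x2 * M2 n2 (x2 - 1)"
    unfolding M1_def M2_def
    by (rule Meixner_raise [OF assms(1,3)] Meixner_raise [OF assms(2,3)])+
  have raise_x:
    "c * (\<beta>1 + real x1) * M1 n1 (Suc x1) =
      c * (real n1 + real x1 + \<beta>1) * M1 n1 x1 - real n1 * M1 (n1 - 1) x1"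
    "c * (\<beta>2 + real x2) * M2 n2 (Suc x2) =
      c * (real n2 + real x2 + \<beta>2) * M2 n2 x2 - real n2 * M2 (n2 - 1) x2"
    \<comment> \<open>Exchanging degree and variable makes these instances of
      \<open>Meixner_raise\<close> in \<open>x1\<close> and \<open>x2\<close>.\<close>
    unfolding comm(1) [of n1] comm(1) [of "n1 - 1"] comm(2) [of n2] comm(2) [of "n2 - 1"]
      add.commute [of "real n1"] add.commute [of "real n2"]
    unfolding M1_def M2_def
    by (rule Meixner_raise [OF assms(1,3)] Meixner_raise [OF assms(2,3)])+
  have diff:
    "real n1 * (M1 n1 x1 - M1 (n1 - 1) x1) = real x1 * (M1 n1 x1 - M1 n1 (x1 - 1))"
    "real n2 * (M2 n2 x2 - M2 (n2 - 1) x2) = real x2 * (M2 n2 x2 - M2 n2 (x2 - 1))"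
    unfolding M1_def M2_def
    by (rule Meixner_backward_difference_commute [OF assms(1)]
        Meixner_backward_difference_commute [OF assms(2)])+
  \<comment> \<open>After the raised values are eliminated, the products of two lowered values agree
    on both sides. By \<open>diff\<close>, the remaining lowered values enter only through \<open>n1
    * M1 (n1 - 1) x1 - x1 * M1 n1 (x1 - 1) = (n1 - x1) * M1 n1 x1\<close> and its analogue for
    \<open>M2\<close>. What is left is a polynomial multiple of \<open>M1 n1 x1 * M2 n2 x2\<close>
    with coefficient zero.\<close>
  have "c * ?L = c * ?R"
    using raise_n raise_x diff by algebra
  with \<open>c \<noteq> 0\<close> show ?thesis
    by simp
qed

lemma move_nth:
  assumes "i \<noteq> j"
  shows "move n i j $ l = (if l = i then n $ i - 1 else if l = j then Suc (n $ j) else n $ l)"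
  using assms by (auto simp: move_def axis_def)

lemma prod_UNIV_split_two:
  fixes f :: "'a::finite \<Rightarrow> 'b::comm_monoid_mult"
  assumes "i \<noteq> j"
  shows "prod f UNIV = f i * f j * prod f (UNIV - {i, j})"
proof -
  have "prod f UNIV = prod f (UNIV - {i, j}) * prod f {i, j}"
    by (rule prod.subset_diff) auto
  then show ?thesis
    using assms by (simp add: mult.commute)
qed

theorem theorem4p8:
  fixes k :: "real ^ ('n :: {finite, linorder})" and c :: real
  assumes "\<And>j. k $ j > 0" and "0 < c" and "c < 1"
  shows "\<forall>n x :: nat ^ ('n :: {finite, linorder}).
    L_SIP k (\<lambda>m. D_SIP k c m x) n = L_SIP k (\<lambda>y. D_SIP k c n y) x"
proof (intro allI)
  fix n x :: "nat ^ ('n :: {finite, linorder})"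
  let ?g = "\<lambda>i j. (\<Prod>l\<in>UNIV - {i, j}. M_SIP (n $ l) (x $ l) (k $ l) c)"
  let ?M = "\<lambda>i a b. Meixner a (real b) (2 * k $ i) c"
  have D: "D_SIP k c n x = of_real (?M i (n $ i) (x $ i) * ?M j (n $ j) (x $ j) * ?g i j)"
    if "i \<noteq> j" for i j
    using that by (simp only: D_SIP_def prod_UNIV_split_two [OF that] M_SIP_def)
  have move_n: "D_SIP k c (move n i j) x =
      of_real (?M i (n $ i - 1) (x $ i) * ?M j (Suc (n $ j)) (x $ j) * ?g i j)"
    if "i \<noteq> j" for i j
  proof -
    have "(\<Prod>l\<in>UNIV - {i, j}. M_SIP (move n i j $ l) (x $ l) (k $ l) c) = ?g i j"
      by (rule prod.cong) (auto simp: move_nth [OF that])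
    then show ?thesis
      using that by (simp add: D_SIP_def prod_UNIV_split_two [OF that] M_SIP_def move_nth)
  qed
  have move_x: "D_SIP k c n (move x i j) =
      of_real (?M i (n $ i) (x $ i - 1) * ?M j (n $ j) (Suc (x $ j)) * ?g i j)"
    if "i \<noteq> j" for i j
  proof -
    have "(\<Prod>l\<in>UNIV - {i, j}. M_SIP (n $ l) (move x i j $ l) (k $ l) c) = ?g i j"
      by (rule prod.cong) (auto simp: move_nth [OF that])
    then show ?thesis
      using that by (simp add: D_SIP_def prod_UNIV_split_two [OF that] M_SIP_def move_nth)
  qed
  have pair:
    "of_real (real (n $ i) * (2 * k $ j + real (n $ j))) * (D_SIP k c (move n i j) x - D_SIP k c n x) +
     of_real (real (n $ j) * (2 * k $ i + real (n $ i))) * (D_SIP k c (move n j i) x - D_SIP k c n x) =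
     of_real (real (x $ i) * (2 * k $ j + real (x $ j))) * (D_SIP k c n (move x i j) - D_SIP k c n x) +
     of_real (real (x $ j) * (2 * k $ i + real (x $ i))) * (D_SIP k c n (move x j i) - D_SIP k c n x)"
    if "i < j" for i j
  proof -
    have ij: "i \<noteq> j" "j \<noteq> i" and g: "?g j i = ?g i j"
      using that by (auto simp: insert_commute)
    have "2 * k $ i > 0" "2 * k $ j > 0" "c \<noteq> 0"
      using assms by auto
    note two = Meixner_two_site_duality [OF this, of "n $ i" "n $ j" "x $ i" "x $ j"]
    \<comment> \<open>Once the embedding into the complex numbers is stripped, this is
      \<open>two\<close> multiplied by the spectator factor \<open>?g i j\<close>.\<close>
    show ?thesis
      unfolding D [OF ij(1)] move_n [OF ij(1)] move_n [OF ij(2)] move_x [OF ij(1)]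
        move_x [OF ij(2)] g of_real_mult [symmetric] of_real_add [symmetric]
        of_real_diff [symmetric] of_real_eq_iff
      using two by algebra
  qed
  \<comment> \<open>Duality holds for each pair of sites separately, so the two sums agree term by
    term.\<close>
  show "L_SIP k (\<lambda>m. D_SIP k c m x) n = L_SIP k (\<lambda>y. D_SIP k c n y) x"
    unfolding L_SIP_def by (rule sum.cong) (use pair in auto)
qed

end
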